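(* Let $\mathbf{S}$ be a schema, let $\mathcal{C}$ be a collection of $\mathbf{S}$-structures (closed under isomorphism), and let $n,m\geq 0$ with $n+m>0$ and $\ell>0$ be integers. The following are equivalent: (1) $\mathcal{C}$ is finitely axiomatizable by linear $(n,m,\ell)$-dexrs; (2) $\mathcal{C}$ is critical, closed under repairable direct products, and linear-diagrammatically $(n,m,\ell)$-compatible.
   Context: Fix a countably infinite set $\mathbf{C}$ of constants and a disjoint set of variables. A schema $\mathbf{S}$ is a finite set of relation symbols, each with a positive arity $\mathrm{ar}(R)$. An $\mathbf{S}$-structure $I$ consists of a (finite or infinite) domain $\mathrm{dom}(I)\subseteq\mathbf{C}$ and a relation $R^I\subseteq\mathrm{dom}(I)^{\mathrm{ar}(R)}$ for each $R\in\mathbf{S}$. Its facts are the expressions $R(\bar c)$ with $\bar c\in R^I$, forming $\mathrm{facts}(I)$; its active domain $\mathrm{adom}(I)$ is the set of elements occurring in some fact. $J\subseteq I$ means $\mathrm{facts}(J)\subseteq\mathrm{facts}(I)$. Homomorphisms and isomorphisms are as usual; all collections of structures are assumed closed under isomorphism. A disjunctive existential rule (dexr) over $\mathbf{S}$ is a constant-free sentence $\forall\bar x\forall\bar y\,(\phi(\bar x,\bar y)\rightarrow\bigvee_{i=1}^k\exists\bar z_i\,\psi_i(\bar x_i,\bar z_i))$ where $k>0$, $\phi$ is a (possibly empty) conjunction of atoms over $\mathbf{S}$ (atoms $R(\bar v)$ with $\bar v$ a tuple of variables), each $\psi_i$ is a non-empty conjunction of atoms over $\mathbf{S}$, the variables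 of $\bar x_i$ occur in $\bar x$, and each variable of $\bar x$ occurs in some $\bar x_i$; satisfaction is the usual first-order one. It is an $(n,m,\ell)$-dexr if its body mentions at most $n$ variables, each head disjunct has at most $m$ existentially quantified variables, and there are at most $\ell$ head disjuncts. It is linear if its body has at most one atom. $\mathcal{C}$ is finitely axiomatizable by a class of dexrs if there is a finite set $\Sigma$ of dexrs over $\mathbf{S}$ from that class such that for every $\mathbf{S}$-structure $I$: $I\in\mathcal{C}$ iff $I\models\Sigma$. Criticality: $I$ is $\kappa$-critical if $|\mathrm{dom}(I)|=\kappa$ and $R^I=\mathrm{dom}(I)^{\mathrm{ar}(R)}$ for all $R$; $\mathcal{C}$ is critical if for every $\kappa>0$ it contains a $\kappa$-critical structure. Repairable direct products: $I\otimes J$ has domain $\mathrm{dom}(I)\times\mathrm{dom}(J)$ and $((a_1,b_1),\dots,(a_r,b_r))\in R^{I\otimes J}$ iff $(a_1,\dots,a_r)\in R^I$ and $(b_1,\dots,b_r)\in R^J$; $\pi(a,b)=a$. A repairable direct product of $I$ and $J$ is an $\mathbf{S}$-structure $L$ with $I\otimes J\subseteq L$ such that some extension of $\pi$ is a homomorphism from $L$ to $I$. $\mathcal{C}$ is closed under repairable direct products if for all $I,J\in\mathcal{C}$ some repairable direct product of $I$ and $J$ is in $\mathcal{C}$. Diagrams: sentences may mention constants, interpreted as themselves. For an $\mathbf{S}$-structure $I$, a finite structure $K\subseteq I$ with $\mathrm{dom}(K)=\mathrm{adom}(K)$, and $m\geq0$: with distinct variables $y_1,\dots,y_m$, $A_{K,m}$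 is the set of atoms $R(\bar u)$, $R\in\mathbf{S}$, $\bar u\in(\mathrm{dom}(K)\cup\{y_1,\dots,y_m\})^{\mathrm{ar}(R)}$; $C_{K,m}$ the set of conjunctions of such atoms; $N^I_{K,m}=\{\gamma(\bar y)\in C_{K,m}:I\not\models\exists\bar y\,\gamma(\bar y)\}$. For $G\subseteq N^I_{K,m}$, $\Delta^I_{K,G}=\bigwedge_{\alpha\in\mathrm{facts}(K)}\alpha\wedge\bigwedge_{c\neq d\in\mathrm{dom}(K)}\neg(c=d)\wedge\bigwedge_{\gamma\in G}\neg\exists\bar y\,\gamma(\bar y)$. An $(m,\ell)$-diagram of $K$ relative to $I$ is such a $\Delta^I_{K,G}$ with $|G|\leq\ell$. A structure $K$ is linear if $|\mathrm{facts}(K)|\leq1$. $\mathcal{C}$ is linear-diagrammatically $(n,m,\ell)$-compatible with $I$ if for every linear structure $K\subseteq I$ with $\mathrm{dom}(K)=\mathrm{adom}(K)$ and $|\mathrm{dom}(K)|\leq n$, and every $(m,\ell)$-diagram $\Delta$ of $K$ relative to $I$, some $J\in\mathcal{C}$ satisfies $\Delta$. $\mathcal{C}$ is linear-diagrammatically $(n,m,\ell)$-compatible if every $\mathbf{S}$-structure $I$ with which $\mathcal{C}$ is linear-diagrammatically $(n,m,\ell)$-compatible belongs to $\mathcal{C}$. *)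

theory Defs
  imports Main "HOL-Library.Countable_Set"
begin

(* The type variable 'c is the countably infinite set of constants.
   Tuples are lists. *)

definition schema :: "'r set \<Rightarrow> ('r \<Rightarrow> nat) \<Rightarrow> bool" where
  "schema S ar \<longleftrightarrow> finite S \<and> (\<forall>R\<in>S. ar R > 0)"

record ('r, 'c) rstruct =
  sdom :: "'c set"
  srel :: "'r \<Rightarrow> 'c list set"

definition tuples :: "nat \<Rightarrow> 'a set \<Rightarrow> 'a list set" where
  "tuples k A = {t. length t = k \<and> set t \<subseteq> A}"

(* Symbols outside the schema are given the empty relation, so that a structure is
   determined by its domain and its S-relations. *)
definition is_struct :: "'r set \<Rightarrow> ('r \<Rightarrow> nat) \<Rightarrow> ('r, 'c) rstruct \<Rightarrow> bool" where
  "is_struct S ar I \<longleftrightarrow>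
     (\<forall>R\<in>S. srel I R \<subseteq> tuples (ar R) (sdom I)) \<and> (\<forall>R. R \<notin> S \<longrightarrow> srel I R = {})"

definition facts :: "('r, 'c) rstruct \<Rightarrow> ('r \<times> 'c list) set" where
  "facts I = {(R, t). t \<in> srel I R}"

definition adom :: "('r, 'c) rstruct \<Rightarrow> 'c set" where
  "adom I = (\<Union>(R, t)\<in>facts I. set t)"

(* Only facts are compared, not domains. *)
definition substruct :: "('r, 'c) rstruct \<Rightarrow> ('r, 'c) rstruct \<Rightarrow> bool" where
  "substruct J I \<longleftrightarrow> facts J \<subseteq> facts I"

definition hom :: "('a \<Rightarrow> 'b) \<Rightarrow> ('r, 'a) rstruct \<Rightarrow> ('r, 'b) rstruct \<Rightarrow> bool" where
  "hom h I J \<longleftrightarrow> h ` sdom I \<subseteq> sdom J \<and> (\<forall>R. \<forall>t\<in>srel I R. map h t \<in> srel J R)"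

definition iso :: "('a \<Rightarrow> 'b) \<Rightarrow> ('r, 'a) rstruct \<Rightarrow> ('r, 'b) rstruct \<Rightarrow> bool" where
  "iso f I J \<longleftrightarrow> bij_betw f (sdom I) (sdom J) \<and>
     (\<forall>R t. set t \<subseteq> sdom I \<longrightarrow> (t \<in> srel I R \<longleftrightarrow> map f t \<in> srel J R))"

definition collection :: "'r set \<Rightarrow> ('r \<Rightarrow> nat) \<Rightarrow> ('r, 'c) rstruct set \<Rightarrow> bool" where
  "collection S ar \<C> \<longleftrightarrow> (\<forall>I\<in>\<C>. is_struct S ar I) \<and>
     (\<forall>I\<in>\<C>. \<forall>J. is_struct S ar J \<and> (\<exists>f. iso f I J) \<longrightarrow> J \<in> \<C>)"

(* Atoms over terms of type 't, evaluated by a map from terms to domain elements.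
   Conjunctions are lists of atoms. *)
type_synonym ('r, 't) atom = "'r \<times> 't list"

definition atom_over :: "'r set \<Rightarrow> ('r \<Rightarrow> nat) \<Rightarrow> 't set \<Rightarrow> ('r, 't) atom \<Rightarrow> bool" where
  "atom_over S ar T \<alpha> \<longleftrightarrow> fst \<alpha> \<in> S \<and> snd \<alpha> \<in> tuples (ar (fst \<alpha>)) T"

definition conj_true :: "('r, 'c) rstruct \<Rightarrow> ('t \<Rightarrow> 'c) \<Rightarrow> ('r, 't) atom list \<Rightarrow> bool" where
  "conj_true I v \<phi> \<longleftrightarrow> (\<forall>(R, ts)\<in>set \<phi>. map v ts \<in> srel I R)"

definition conj_vars :: "('r, 't) atom list \<Rightarrow> 't set" where
  "conj_vars \<phi> = (\<Union>(R, ts)\<in>set \<phi>. set ts)"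

(* Variables are natural numbers. The universally quantified variables are those of
   the body; the existentially quantified variables of a head disjunct are its
   variables that do not occur in the body. *)
record 'r dexr =
  body :: "('r, nat) atom list"
  heads :: "('r, nat) atom list list"

definition is_dexr :: "'r set \<Rightarrow> ('r \<Rightarrow> nat) \<Rightarrow> 'r dexr \<Rightarrow> bool" where
  "is_dexr S ar \<sigma> \<longleftrightarrow> heads \<sigma> \<noteq> [] \<and> (\<forall>\<alpha>\<in>set (body \<sigma>). atom_over S ar UNIV \<alpha>) \<and>
     (\<forall>\<psi>\<in>set (heads \<sigma>). \<psi> \<noteq> [] \<and> (\<forall>\<alpha>\<in>set \<psi>. atom_over S ar UNIV \<alpha>))"

definition ex_vars :: "'r dexr \<Rightarrow> ('r, nat) atom list \<Rightarrow> nat set" where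
  "ex_vars \<sigma> \<psi> = conj_vars \<psi> - conj_vars (body \<sigma>)"

definition bounded_dexr :: "nat \<Rightarrow> nat \<Rightarrow> nat \<Rightarrow> 'r dexr \<Rightarrow> bool" where
  "bounded_dexr n m l \<sigma> \<longleftrightarrow> card (conj_vars (body \<sigma>)) \<le> n \<and>
     (\<forall>\<psi>\<in>set (heads \<sigma>). card (ex_vars \<sigma> \<psi>) \<le> m) \<and> length (heads \<sigma>) \<le> l"

definition linear_dexr :: "'r dexr \<Rightarrow> bool" where
  "linear_dexr \<sigma> \<longleftrightarrow> length (body \<sigma>) \<le> 1"

definition sat_dexr :: "('r, 'c) rstruct \<Rightarrow> 'r dexr \<Rightarrow> bool" where
  "sat_dexr I \<sigma> \<longleftrightarrow>
     (\<forall>v. v ` conj_vars (body \<sigma>) \<subseteq> sdom I \<and> conj_true I v (body \<sigma>) \<longrightarrow>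
       (\<exists>\<psi>\<in>set (heads \<sigma>). \<exists>w. (\<forall>x\<in>conj_vars (body \<sigma>). w x = v x) \<and>
          w ` ex_vars \<sigma> \<psi> \<subseteq> sdom I \<and> conj_true I w \<psi>))"

definition finitely_axiomatizable_by ::
    "'r set \<Rightarrow> ('r \<Rightarrow> nat) \<Rightarrow> ('r dexr \<Rightarrow> bool) \<Rightarrow> ('r, 'c) rstruct set \<Rightarrow> bool" where
  "finitely_axiomatizable_by S ar P \<C> \<longleftrightarrow>
     (\<exists>\<Sigma>. finite \<Sigma> \<and> (\<forall>\<sigma>\<in>\<Sigma>. is_dexr S ar \<sigma> \<and> P \<sigma>) \<and>
       (\<forall>I. is_struct S ar I \<longrightarrow> (I \<in> \<C> \<longleftrightarrow> (\<forall>\<sigma>\<in>\<Sigma>. sat_dexr I \<sigma>))))"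

definition k_critical :: "'r set \<Rightarrow> ('r \<Rightarrow> nat) \<Rightarrow> nat \<Rightarrow> ('r, 'c) rstruct \<Rightarrow> bool" where
  "k_critical S ar \<kappa> I \<longleftrightarrow> finite (sdom I) \<and> card (sdom I) = \<kappa> \<and>
     (\<forall>R\<in>S. srel I R = tuples (ar R) (sdom I))"

definition critical :: "'r set \<Rightarrow> ('r \<Rightarrow> nat) \<Rightarrow> ('r, 'c) rstruct set \<Rightarrow> bool" where
  "critical S ar \<C> \<longleftrightarrow> (\<forall>\<kappa>>0. \<exists>I\<in>\<C>. k_critical S ar \<kappa> I)"

definition direct_product ::
    "('r, 'a) rstruct \<Rightarrow> ('r, 'b) rstruct \<Rightarrow> ('r, 'a \<times> 'b) rstruct" where
  "direct_product I J = \<lparr>sdom = sdom I \<times> sdom J,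
     srel = (\<lambda>R. {t. map fst t \<in> srel I R \<and> map snd t \<in> srel J R})\<rparr>"

(* The elements of the product are pairs of constants, whereas structures have constants
   as elements; hence the product is replaced by an isomorphic copy P over 'c, with e
   the isomorphism. A map defined on the domain of L can extend the projection only if
   the domain of L includes that of the product, which substruct does not provide. *)
definition repairable_product ::
    "'r set \<Rightarrow> ('r \<Rightarrow> nat) \<Rightarrow> ('r, 'c) rstruct \<Rightarrow> ('r, 'c) rstruct \<Rightarrow> ('r, 'c) rstruct \<Rightarrow> bool" where
  "repairable_product S ar I J L \<longleftrightarrow> is_struct S ar L \<and>
     (\<exists>P e h. is_struct S ar P \<and> iso e (direct_product I J) P \<and>
        substruct P L \<and> sdom P \<subseteq> sdom L \<and>
        hom h L I \<and> (\<forall>p\<in>sdom (direct_product I J). h (e p) = fst p))"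

definition closed_repairable_products ::
    "'r set \<Rightarrow> ('r \<Rightarrow> nat) \<Rightarrow> ('r, 'c) rstruct set \<Rightarrow> bool" where
  "closed_repairable_products S ar \<C> \<longleftrightarrow>
     (\<forall>I\<in>\<C>. \<forall>J\<in>\<C>. \<exists>L\<in>\<C>. repairable_product S ar I J L)"

(* YVar i with i < m stands for the variable y_(i+1). *)
datatype 'c trm = Const 'c | YVar nat

primrec trm_val :: "(nat \<Rightarrow> 'c) \<Rightarrow> 'c trm \<Rightarrow> 'c" where
  "trm_val v (Const c) = c"
| "trm_val v (YVar i) = v i"

definition sat_ex :: "('r, 'c) rstruct \<Rightarrow> nat \<Rightarrow> ('r, 'c trm) atom list \<Rightarrow> bool" where
  "sat_ex I m \<gamma> \<longleftrightarrow> (\<exists>v. (\<forall>i<m. v i \<in> sdom I) \<and> conj_true I (trm_val v) \<gamma>)"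

definition diag_atoms ::
    "'r set \<Rightarrow> ('r \<Rightarrow> nat) \<Rightarrow> ('r, 'c) rstruct \<Rightarrow> nat \<Rightarrow> ('r, 'c trm) atom set" where
  "diag_atoms S ar K m = {\<alpha>. atom_over S ar (Const ` sdom K \<union> YVar ` {..<m}) \<alpha>}"

(* Conjunctions are non-empty, as are the head disjuncts of rules. *)
definition diag_conjs ::
    "'r set \<Rightarrow> ('r \<Rightarrow> nat) \<Rightarrow> ('r, 'c) rstruct \<Rightarrow> nat \<Rightarrow> ('r, 'c trm) atom list set" where
  "diag_conjs S ar K m = {\<gamma>. \<gamma> \<noteq> [] \<and> set \<gamma> \<subseteq> diag_atoms S ar K m}"

definition neg_conjs ::
    "'r set \<Rightarrow> ('r \<Rightarrow> nat) \<Rightarrow> ('r, 'c) rstruct \<Rightarrow> ('r, 'c) rstruct \<Rightarrow> nat \<Rightarrow>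
     ('r, 'c trm) atom list set" where
  "neg_conjs S ar I K m = {\<gamma> \<in> diag_conjs S ar K m. \<not> sat_ex I m \<gamma>}"

(* The conjuncts of a diagram: R(t), not (c = d), and not (exists y_1 ... y_m. gamma). *)
datatype ('r, 'c) diag_conjunct =
    Fact 'r "'c list"
  | Neq 'c 'c
  | NegEx nat "('r \<times> 'c trm list) list"

primrec sat_conjunct :: "('r, 'c) rstruct \<Rightarrow> ('r, 'c) diag_conjunct \<Rightarrow> bool" where
  "sat_conjunct J (Fact R t) \<longleftrightarrow> t \<in> srel J R"
| "sat_conjunct J (Neq c d) \<longleftrightarrow> c \<noteq> d"
| "sat_conjunct J (NegEx m \<gamma>) \<longleftrightarrow> \<not> sat_ex J m \<gamma>"

definition diagram ::
    "('r, 'c) rstruct \<Rightarrow> nat \<Rightarrow> ('r, 'c trm) atom list set \<Rightarrow> ('r, 'c) diag_conjunct set" where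
  "diagram K m G =
     {Fact R t | R t. (R, t) \<in> facts K} \<union>
     {Neq c d | c d. c \<in> sdom K \<and> d \<in> sdom K \<and> c \<noteq> d} \<union>
     {NegEx m \<gamma> | \<gamma>. \<gamma> \<in> G}"

definition is_diagram ::
    "'r set \<Rightarrow> ('r \<Rightarrow> nat) \<Rightarrow> nat \<Rightarrow> nat \<Rightarrow> ('r, 'c) rstruct \<Rightarrow> ('r, 'c) rstruct \<Rightarrow>
     ('r, 'c) diag_conjunct set \<Rightarrow> bool" where
  "is_diagram S ar m l I K \<Delta> \<longleftrightarrow>
     (\<exists>G. G \<subseteq> neg_conjs S ar I K m \<and> finite G \<and> card G \<le> l \<and> \<Delta> = diagram K m G)"

definition linear_struct :: "('r, 'c) rstruct \<Rightarrow> bool" where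
  "linear_struct K \<longleftrightarrow> finite (facts K) \<and> card (facts K) \<le> 1"

definition lin_diag_compatible_with ::
    "'r set \<Rightarrow> ('r \<Rightarrow> nat) \<Rightarrow> nat \<Rightarrow> nat \<Rightarrow> nat \<Rightarrow> ('r, 'c) rstruct set \<Rightarrow> ('r, 'c) rstruct \<Rightarrow> bool" where
  "lin_diag_compatible_with S ar n m l \<C> I \<longleftrightarrow>
     (\<forall>K. is_struct S ar K \<and> linear_struct K \<and> substruct K I \<and> sdom K = adom K \<and>
          finite (sdom K) \<and> card (sdom K) \<le> n \<longrightarrow>
        (\<forall>\<Delta>. is_diagram S ar m l I K \<Delta> \<longrightarrow> (\<exists>J\<in>\<C>. \<forall>\<delta>\<in>\<Delta>. sat_conjunct J \<delta>)))"

definition lin_diag_compatible ::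
    "'r set \<Rightarrow> ('r \<Rightarrow> nat) \<Rightarrow> nat \<Rightarrow> nat \<Rightarrow> nat \<Rightarrow> ('r, 'c) rstruct set \<Rightarrow> bool" where
  "lin_diag_compatible S ar n m l \<C> \<longleftrightarrow>
     (\<forall>I. is_struct S ar I \<and> lin_diag_compatible_with S ar n m l \<C> I \<longrightarrow> I \<in> \<C>)"

end

theory Submission
  imports Defs
begin

text \<open>
  The axiomatizing set consists of all linear rules over the variables \<open>0, \<dots>, n + m - 1\<close>
  that hold throughout the collection. A diagram of \<open>K\<close> relative to a model \<open>I\<close> of these rules
  is turned into a rule by reading the elements of \<open>K\<close> as variables. This rule fails in \<open>I\<close>,
  so it fails in some member \<open>J\<close>, which gives a homomorphism from \<open>K\<close> to \<open>J\<close>. That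
  homomorphism may identify elements; the repairable product of \<open>J\<close> with a large critical
  structure makes it injective, and the projection back to \<open>J\<close> preserves the negative part of the
  diagram. Conversely, the class of models of a set of rules is closed under inverse images along
  surjections, and the inverse image of \<open>I\<close> along the projection is a repairable product of \<open>I\<close>
  with every \<open>J\<close>.
\<close>

section \<open>Direct and inverse images of structures, and copies of products\<close>

definition rename :: "('a \<Rightarrow> 'b) \<Rightarrow> ('r, 'a) rstruct \<Rightarrow> ('r, 'b) rstruct" where
  "rename f I = \<lparr>sdom = f ` sdom I, srel = (\<lambda>R. map f ` srel I R)\<rparr>"

text \<open>The largest structure for which \<open>h\<close> is a homomorphism to \<open>I\<close>.
  Conjunctions hold in it exactly when their images under \<open>h\<close> hold in \<open>I\<close>,
  which is why rules transfer to it.\<close>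

definition pullback :: "('a \<Rightarrow> 'b) \<Rightarrow> ('r, 'b) rstruct \<Rightarrow> ('r, 'a) rstruct" where
  "pullback h I = \<lparr>sdom = h -` sdom I, srel = (\<lambda>R. {t. map h t \<in> srel I R})\<rparr>"

lemma is_structD:
  assumes "is_struct S ar I" "t \<in> srel I R"
  shows "R \<in> S" "length t = ar R" "set t \<subseteq> sdom I"
  using assms by (auto simp: is_struct_def tuples_def)

lemma is_struct_rename: "is_struct S ar I \<Longrightarrow> is_struct S ar (rename f I)"
  by (fastforce simp: is_struct_def tuples_def rename_def)

lemma is_struct_pullback: "is_struct S ar I \<Longrightarrow> is_struct S ar (pullback h I)"
  by (fastforce simp: is_struct_def tuples_def pullback_def)

lemma is_struct_direct_product:
  assumes "is_struct S ar I" "is_struct S ar J"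
  shows "is_struct S ar (direct_product I J)"
proof -
  have "length t = ar R \<and> set t \<subseteq> sdom I \<times> sdom J"
    if "map fst t \<in> srel I R" "map snd t \<in> srel J R" for R t
    using is_structD(2,3)[OF assms(1) that(1)] is_structD(3)[OF assms(2) that(2)]
    by (force simp: image_subset_iff)
  then show ?thesis
    using assms by (auto simp: is_struct_def direct_product_def tuples_def)
qed

lemma iso_rename:
  assumes "inj f"
  shows "iso f I (rename f I)"
  using assms inj_mapI[OF assms]
  by (auto simp: iso_def rename_def bij_betw_def inj_on_def)

lemma collection_rename:
  assumes "collection S ar \<C>" "I \<in> \<C>" "inj f"
  shows "rename f I \<in> \<C>"
  using assms iso_rename[OF assms(3)] is_struct_rename unfolding collection_def by blast

lemma collection_is_struct: "collection S ar \<C> \<Longrightarrow> I \<in> \<C> \<Longrightarrow> is_struct S ar I"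
  by (simp add: collection_def)

section \<open>Truth of conjunctions under assignments and substitutions\<close>

lemma conj_true_sdom:
  assumes "is_struct S ar I" "conj_true I v \<phi>"
  shows "v ` conj_vars \<phi> \<subseteq> sdom I"
proof -
  have "v x \<in> sdom I" if "(R, ts) \<in> set \<phi>" "x \<in> set ts" for R ts x
  proof -
    have "map v ts \<in> srel I R" using assms(2) that(1) by (auto simp: conj_true_def)
    from is_structD(3)[OF assms(1) this] that(2) show ?thesis by auto
  qed
  then show ?thesis by (auto simp: conj_vars_def)
qed

lemma conj_true_cong:
  assumes "\<And>x. x \<in> conj_vars \<phi> \<Longrightarrow> v x = w x"
  shows "conj_true I v \<phi> = conj_true I w \<phi>"
proof -
  have "map v ts = map w ts" if "(R, ts) \<in> set \<phi>" for R ts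
    using assms that by (force simp: conj_vars_def)
  then show ?thesis unfolding conj_true_def by (metis (mono_tags, lifting) case_prodI2 case_prodD)
qed

text \<open>A single substitution that may change the type of terms: it instantiates rule bodies by
  constants, and translates between rule variables and the terms of diagrams.\<close>

definition map_conj :: "('s \<Rightarrow> 't) \<Rightarrow> ('r, 's) atom list \<Rightarrow> ('r, 't) atom list" where
  "map_conj f \<phi> = map (\<lambda>(R, ts). (R, map f ts)) \<phi>"

lemma conj_true_map_conj: "conj_true I v (map_conj f \<phi>) = conj_true I (v \<circ> f) \<phi>"
  by (auto simp: conj_true_def map_conj_def)

lemma conj_vars_map_conj: "conj_vars (map_conj f \<phi>) = f ` conj_vars \<phi>"
  by (force simp: conj_vars_def map_conj_def)

lemma map_conj_eq_Nil [simp]: "map_conj f \<phi> = [] \<longleftrightarrow> \<phi> = []"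
  by (simp add: map_conj_def)

lemma conj_true_hom:
  assumes "hom h I J" "conj_true I v \<phi>"
  shows "conj_true J (h \<circ> v) \<phi>"
  using assms by (fastforce simp: conj_true_def hom_def)

lemma atom_over_map_conj:
  assumes "\<forall>\<alpha>\<in>set \<phi>. atom_over S ar A \<alpha>" "f ` A \<subseteq> B"
  shows "\<forall>\<alpha>\<in>set (map_conj f \<phi>). atom_over S ar B \<alpha>"
  using assms by (fastforce simp: atom_over_def map_conj_def tuples_def)

lemma atom_over_conj_vars:
  "\<forall>\<alpha>\<in>set \<phi>. atom_over S ar UNIV \<alpha> \<Longrightarrow> \<forall>\<alpha>\<in>set \<phi>. atom_over S ar (conj_vars \<phi>) \<alpha>"
  by (fastforce simp: atom_over_def conj_vars_def tuples_def)

lemma conj_vars_atom_over: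
  "\<forall>\<alpha>\<in>set \<phi>. atom_over S ar A \<alpha> \<Longrightarrow> conj_vars \<phi> \<subseteq> A"
  by (fastforce simp: atom_over_def conj_vars_def tuples_def)

text \<open>Arities are positive, so every atom has an argument. With \<open>conj_true_sdom\<close>,
  a true non-empty conjunction then yields a domain element, a default value for those
  \<open>y\<close> variables that do not occur: \<open>sat_ex\<close> demands values for all of
  them.\<close>

lemma conj_vars_nonempty:
  assumes "schema S ar" "\<phi> \<noteq> []" "\<forall>\<alpha>\<in>set \<phi>. atom_over S ar A \<alpha>"
  shows "conj_vars \<phi> \<noteq> {}"
proof -
  obtain R ts where "(R, ts) \<in> set \<phi>" using assms(2) by (cases \<phi>) auto
  moreover from this have "ts \<noteq> []"
    using assms(1,3) by (fastforce simp: schema_def atom_over_def tuples_def)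
  ultimately show ?thesis by (force simp: conj_vars_def)
qed

section \<open>Critical structures satisfy every rule\<close>

lemma conj_true_critical:
  assumes "\<And>R. R \<in> S \<Longrightarrow> srel I R = tuples (ar R) (sdom I)"
    and "\<forall>\<alpha>\<in>set \<phi>. atom_over S ar A \<alpha>" "v ` A \<subseteq> sdom I"
  shows "conj_true I v \<phi>"
proof -
  have "map v ts \<in> srel I R" if "(R, ts) \<in> set \<phi>" for R ts
  proof -
    have "R \<in> S" "ts \<in> tuples (ar R) A" using assms(2) that by (auto simp: atom_over_def)
    then show ?thesis using assms(1)[of R] assms(3) by (fastforce simp: tuples_def)
  qed
  then show ?thesis by (auto simp: conj_true_def)
qed

text \<open>Any assignment into the domain makes any head disjunct true, and \<open>is_dexr\<close>
  guarantees a disjunct. The condition \<open>\<kappa> > 0\<close> supplies a value for the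
  existential variables.\<close>

lemma sat_dexr_critical:
  assumes "k_critical S ar \<kappa> I" "\<kappa> > 0" "is_dexr S ar \<sigma>"
  shows "sat_dexr I \<sigma>"
  unfolding sat_dexr_def
proof (intro allI impI)
  fix v assume v: "v ` conj_vars (body \<sigma>) \<subseteq> sdom I \<and> conj_true I v (body \<sigma>)"
  obtain \<psi> where \<psi>: "\<psi> \<in> set (heads \<sigma>)" "\<forall>\<alpha>\<in>set \<psi>. atom_over S ar UNIV \<alpha>"
    using assms(3) by (cases "heads \<sigma>") (auto simp: is_dexr_def)
  obtain a where a: "a \<in> sdom I" using assms(1,2) by (fastforce simp: k_critical_def)
  define w where "w x = (if x \<in> conj_vars (body \<sigma>) then v x else a)" for x
  have w: "range w \<subseteq> sdom I" using v a by (auto simp: w_def)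
  have "conj_true I w \<psi>"
    by (rule conj_true_critical[OF _ \<psi>(2) w]) (use assms(1) in \<open>simp add: k_critical_def\<close>)
  moreover have "\<forall>x\<in>conj_vars (body \<sigma>). w x = v x" by (simp add: w_def)
  ultimately show "\<exists>\<psi>\<in>set (heads \<sigma>). \<exists>w. (\<forall>x\<in>conj_vars (body \<sigma>). w x = v x) \<and>
          w ` ex_vars \<sigma> \<psi> \<subseteq> sdom I \<and> conj_true I w \<psi>"
    using \<psi>(1) w by blast
qed

section \<open>Inverse images of models as repairable products\<close>

lemma conj_true_pullback: "conj_true (pullback h I) v \<phi> = conj_true I (h \<circ> v) \<phi>"
  by (simp add: conj_true_def pullback_def)

lemma not_sat_dexrE:
  assumes "\<not> sat_dexr I \<sigma>"
  obtains v where "v ` conj_vars (body \<sigma>) \<subseteq> sdom I" "conj_true I v (body \<sigma>)"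
    "\<And>\<psi> w. \<psi> \<in> set (heads \<sigma>) \<Longrightarrow> \<forall>x\<in>conj_vars (body \<sigma>). w x = v x \<Longrightarrow>
        w ` ex_vars \<sigma> \<psi> \<subseteq> sdom I \<Longrightarrow> \<not> conj_true I w \<psi>"
proof -
  from assms obtain v where v: "v ` conj_vars (body \<sigma>) \<subseteq> sdom I" "conj_true I v (body \<sigma>)"
    and no: "\<not> (\<exists>\<psi>\<in>set (heads \<sigma>). \<exists>w. (\<forall>x\<in>conj_vars (body \<sigma>). w x = v x) \<and>
      w ` ex_vars \<sigma> \<psi> \<subseteq> sdom I \<and> conj_true I w \<psi>)"
    unfolding sat_dexr_def not_all not_imp by (elim exE conjE)
  from v show thesis by (rule that) (use no in blast)
qed

lemma sat_dexrE:
  assumes "sat_dexr I \<sigma>" "v ` conj_vars (body \<sigma>) \<subseteq> sdom I" "conj_true I v (body \<sigma>)"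
  obtains \<psi> w where "\<psi> \<in> set (heads \<sigma>)" "\<forall>x\<in>conj_vars (body \<sigma>). w x = v x"
    "w ` ex_vars \<sigma> \<psi> \<subseteq> sdom I" "conj_true I w \<psi>"
  using assms(1)[unfolded sat_dexr_def, THEN spec, THEN mp, OF conjI[OF assms(2,3)]]
  by (elim bexE exE conjE) (rule that)

lemma sat_dexr_pullback:
  assumes "surj h" "sat_dexr I \<sigma>"
  shows "sat_dexr (pullback h I) \<sigma>"
  unfolding sat_dexr_def
proof (intro allI impI)
  fix v
  assume v: "v ` conj_vars (body \<sigma>) \<subseteq> sdom (pullback h I) \<and> conj_true (pullback h I) v (body \<sigma>)"
  then have hv: "(h \<circ> v) ` conj_vars (body \<sigma>) \<subseteq> sdom I" "conj_true I (h \<circ> v) (body \<sigma>)"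
    by (simp_all add: conj_true_pullback) (auto simp: pullback_def)
  obtain \<psi> w where w: "\<psi> \<in> set (heads \<sigma>)" "\<forall>x\<in>conj_vars (body \<sigma>). w x = (h \<circ> v) x"
      "w ` ex_vars \<sigma> \<psi> \<subseteq> sdom I" "conj_true I w \<psi>"
    by (rule sat_dexrE[OF assms(2) hv])
  \<comment> \<open>Body variables must keep the values given by \<open>v\<close>; only the
    existential witnesses are lifted along \<open>h\<close>, by choosing preimages.\<close>
  define w' where "w' x = (if x \<in> conj_vars (body \<sigma>) then v x else inv h (w x))" for x
  have hw: "h (w' x) = w x" for x
    using w(2) by (simp add: w'_def surj_f_inv_f[OF assms(1)])
  then have hw': "h \<circ> w' = w" by (simp add: fun_eq_iff)
  have "w' ` ex_vars \<sigma> \<psi> \<subseteq> sdom (pullback h I)"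
    using w(3) hw by (auto simp: pullback_def)
  moreover have "conj_true (pullback h I) w' \<psi>"
    using w(4) unfolding conj_true_pullback hw' .
  ultimately show "\<exists>\<psi>\<in>set (heads \<sigma>). \<exists>w. (\<forall>x\<in>conj_vars (body \<sigma>). w x = v x) \<and>
          w ` ex_vars \<sigma> \<psi> \<subseteq> sdom (pullback h I) \<and> conj_true (pullback h I) w \<psi>"
    using w(1) by (intro bexI[of _ \<psi>] exI[of _ w']) (auto simp: w'_def)
qed

lemma ex_bij_prod:
  assumes "countable (UNIV :: 'c set)" "infinite (UNIV :: 'c set)"
  shows "\<exists>e :: 'c \<times> 'c \<Rightarrow> 'c. bij e"
proof -
  have "countable (UNIV :: ('c \<times> 'c) set)" "infinite (UNIV :: ('c \<times> 'c) set)"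
    using countable_SIGMA[of UNIV "\<lambda>_. UNIV", OF assms(1) assms(1)] assms(2)
    by (simp_all add: finite_prod)
  then obtain f :: "'c \<times> 'c \<Rightarrow> nat" where f: "bij f"
    by (meson countableE_infinite)
  obtain g :: "'c \<Rightarrow> nat" where "bij g"
    using assms by (meson countableE_infinite)
  then have "bij (inv g \<circ> f)" using f by (intro bij_comp bij_imp_bij_inv)
  then show ?thesis by blast
qed

text \<open>A fact of the product projects to a fact of \<open>I\<close>, hence belongs to the
  inverse image, from which the projection is a homomorphism by construction. The bijection
  \<open>e\<close> codes pairs of constants as constants.\<close>

lemma repairable_product_pullback:
  fixes e :: "'c \<times> 'c \<Rightarrow> 'c"
  assumes "is_struct S ar I" "is_struct S ar J" "bij e"
  shows "repairable_product S ar I J (pullback (fst \<circ> inv e) I)"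
proof -
  let ?h = "fst \<circ> inv e" and ?P = "rename e (direct_product I J)"
  have he: "?h (e p) = fst p" for p
    using assms(3) by (simp add: bij_is_inj)
  have "map (?h \<circ> e) t = map fst t" for t
    using he by simp
  then have "substruct ?P (pullback ?h I)"
    by (auto simp: substruct_def facts_def rename_def direct_product_def pullback_def
        simp flip: map_map simp del: comp_apply)
  moreover have "sdom ?P \<subseteq> sdom (pullback ?h I)"
    using he by (auto simp: rename_def direct_product_def pullback_def)
  moreover have "hom ?h (pullback ?h I) I"
    by (auto simp: hom_def pullback_def)
  ultimately show ?thesis
    unfolding repairable_product_def
    using is_struct_pullback[OF assms(1), of ?h] he
      is_struct_rename[OF is_struct_direct_product[OF assms(1,2)], of e]
      iso_rename[OF bij_is_inj[OF assms(3)], of "direct_product I J"]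
    by blast
qed

lemma ex_k_critical:
  assumes "infinite (UNIV :: 'c set)"
  shows "\<exists>I :: ('r, 'c) rstruct. is_struct S ar I \<and> k_critical S ar \<kappa> I"
proof -
  obtain D :: "'c set" where D: "finite D" "card D = \<kappa>"
    using infinite_arbitrarily_large[OF assms] by blast
  define I :: "('r, 'c) rstruct"
    where "I = \<lparr>sdom = D, srel = (\<lambda>R. if R \<in> S then tuples (ar R) D else {})\<rparr>"
  have "is_struct S ar I" "k_critical S ar \<kappa> I"
    using D by (auto simp: I_def is_struct_def k_critical_def)
  then show ?thesis by blast
qed

section \<open>From valid rules to compatible structures\<close>

text \<open>A violation of \<open>\<sigma>\<close> in \<open>I\<close> can be written as a diagram:
  the instantiated body gives the facts, the head disjuncts give the negated conjunctions. A member
  of the collection with this diagram would violate \<open>\<sigma>\<close> as well.\<close>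

lemma sat_dexr_if_lin_diag_compatible_with:
  fixes I :: "('r, 'c) rstruct"
  assumes "schema S ar" "collection S ar \<C>" "is_struct S ar I"
    and comp: "lin_diag_compatible_with S ar n m l \<C> I"
    and \<sigma>: "is_dexr S ar \<sigma>" "linear_dexr \<sigma>" "bounded_dexr n m l \<sigma>"
    and sat: "\<forall>J\<in>\<C>. sat_dexr J \<sigma>"
  shows "sat_dexr I \<sigma>"
proof (rule ccontr)
  let ?B = "conj_vars (body \<sigma>)"
  assume "\<not> sat_dexr I \<sigma>"
  then obtain v where v: "v ` ?B \<subseteq> sdom I" "conj_true I v (body \<sigma>)"
    and no: "\<And>\<psi> w. \<psi> \<in> set (heads \<sigma>) \<Longrightarrow> \<forall>x\<in>?B. w x = v x \<Longrightarrow>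
        w ` ex_vars \<sigma> \<psi> \<subseteq> sdom I \<Longrightarrow> \<not> conj_true I w \<psi>"
    by (rule not_sat_dexrE) blast
  \<comment> \<open>The body instantiated by \<open>v\<close>. Its at most one atom makes
    \<open>K\<close> linear; \<open>v\<close> may identify variables, so the domain has at most, not
    exactly, as many elements as the body has variables.\<close>
  define K :: "('r, 'c) rstruct"
    where "K = \<lparr>sdom = v ` ?B, srel = (\<lambda>R. {t. (R, t) \<in> set (map_conj v (body \<sigma>))})\<rparr>"
  have factsK: "facts K = set (map_conj v (body \<sigma>))"
    by (auto simp: facts_def K_def)
  have "sdom K = adom K"
    unfolding adom_def factsK by (simp add: K_def flip: conj_vars_map_conj) (simp add: conj_vars_def)
  moreover have "is_struct S ar K"
  proof -
    have "\<forall>\<alpha>\<in>set (map_conj v (body \<sigma>)). atom_over S ar (v ` ?B) \<alpha>"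
      using \<sigma>(1) by (intro atom_over_map_conj[where A = ?B] atom_over_conj_vars)
        (auto simp: is_dexr_def)
    then show ?thesis by (fastforce simp: is_struct_def K_def atom_over_def)
  qed
  moreover have "linear_struct K"
  proof -
    have "card (facts K) \<le> length (map_conj v (body \<sigma>))"
      unfolding factsK by (rule card_length)
    then show ?thesis using \<sigma>(2) by (simp add: linear_struct_def linear_dexr_def factsK map_conj_def)
  qed
  moreover have "substruct K I"
    using v(2) unfolding substruct_def factsK by (auto simp: facts_def map_conj_def conj_true_def)
  moreover have finB: "finite ?B" by (auto simp: conj_vars_def)
  then have "finite (sdom K)" by (simp add: K_def)
  moreover have "card (sdom K) \<le> n"
    using \<sigma>(3) card_image_le[OF finB, of v] by (simp add: K_def bounded_dexr_def)
  ultimately have diag: "\<exists>J\<in>\<C>. \<forall>\<delta>\<in>\<Delta>. sat_conjunct J \<delta>" if "is_diagram S ar m l I K \<Delta>" for \<Delta>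
    using comp that unfolding lin_diag_compatible_with_def by blast
  \<comment> \<open>Each disjunct numbers its existential variables separately. The numbers may be
    reused across disjuncts, since each negated conjunction has its own quantifiers.\<close>
  have "\<exists>g. inj_on g (ex_vars \<sigma> \<psi>) \<and> g ` ex_vars \<sigma> \<psi> \<subseteq> {..<m}" if "\<psi> \<in> set (heads \<sigma>)" for \<psi>
  proof -
    have "finite (ex_vars \<sigma> \<psi>)" by (auto simp: ex_vars_def conj_vars_def)
    moreover have "card (ex_vars \<sigma> \<psi>) \<le> card {..<m}"
      using \<sigma>(3) that by (simp add: bounded_dexr_def)
    ultimately show ?thesis using card_le_inj[of "ex_vars \<sigma> \<psi>" "{..<m}"] by auto
  qed
  then obtain g where g: "\<And>\<psi>. \<psi> \<in> set (heads \<sigma>) \<Longrightarrow> inj_on (g \<psi>) (ex_vars \<sigma> \<psi>)"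
      "\<And>\<psi>. \<psi> \<in> set (heads \<sigma>) \<Longrightarrow> g \<psi> ` ex_vars \<sigma> \<psi> \<subseteq> {..<m}"
    by metis
  define tr where "tr \<psi> x = (if x \<in> ?B then Const (v x) else YVar (g \<psi> x))" for \<psi> x
  define G where "G = (\<lambda>\<psi>. map_conj (tr \<psi>) \<psi>) ` set (heads \<sigma>)"
  have overG: "\<forall>\<alpha>\<in>set (map_conj (tr \<psi>) \<psi>). atom_over S ar (Const ` sdom K \<union> YVar ` {..<m}) \<alpha>"
    if "\<psi> \<in> set (heads \<sigma>)" for \<psi>
    using \<sigma>(1) that g(2)[OF that]
    by (intro atom_over_map_conj[where A = "conj_vars \<psi>"] atom_over_conj_vars)
      (auto simp: is_dexr_def tr_def K_def ex_vars_def)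
  \<comment> \<open>Values of the \<open>y\<close> variables that satisfy a translated disjunct in
    \<open>I\<close> would be existential witnesses for that disjunct, extending
    \<open>v\<close>.\<close>
  have "G \<subseteq> neg_conjs S ar I K m"
  proof -
    have False if \<psi>: "\<psi> \<in> set (heads \<sigma>)" and sat: "sat_ex I m (map_conj (tr \<psi>) \<psi>)" for \<psi>
    proof -
      obtain u where u: "\<forall>i<m. u i \<in> sdom I" "conj_true I (trm_val u \<circ> tr \<psi>) \<psi>"
        using sat by (auto simp: sat_ex_def conj_true_map_conj)
      have "(trm_val u \<circ> tr \<psi>) ` ex_vars \<sigma> \<psi> \<subseteq> sdom I"
        using u(1) g(2)[OF \<psi>] by (auto simp: tr_def ex_vars_def)
      then show False using no[OF \<psi>, of "trm_val u \<circ> tr \<psi>"] u(2) by (auto simp: tr_def)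
    qed
    then show ?thesis
      using overG \<sigma>(1)
      by (auto simp: G_def neg_conjs_def diag_conjs_def diag_atoms_def is_dexr_def)
  qed
  moreover have "card G \<le> l"
    using \<sigma>(3) card_image_le[of "set (heads \<sigma>)" "\<lambda>\<psi>. map_conj (tr \<psi>) \<psi>"] card_length[of "heads \<sigma>"]
    by (simp add: G_def bounded_dexr_def)
  ultimately have "is_diagram S ar m l I K (diagram K m G)"
    unfolding is_diagram_def by (auto simp: G_def)
  then obtain J where J: "J \<in> \<C>" "\<forall>\<delta>\<in>diagram K m G. sat_conjunct J \<delta>"
    using diag by blast
  have structJ: "is_struct S ar J" using J(1) assms(2) by (rule collection_is_struct[rotated])
  have "t \<in> srel J R" if "(R, t) \<in> set (map_conj v (body \<sigma>))" for R t
    using J(2) that by (force simp: diagram_def factsK)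
  \<comment> \<open>Constants denote themselves in diagrams, so the same assignment \<open>v\<close>
    satisfies the body in \<open>J\<close>.\<close>
  then have Jbody: "conj_true J v (body \<sigma>)"
    by (fastforce simp: conj_true_def map_conj_def)
  obtain \<psi> w where \<psi>: "\<psi> \<in> set (heads \<sigma>)" and w: "\<forall>x\<in>?B. w x = v x" "conj_true J w \<psi>"
    by (rule sat_dexrE[OF bspec[OF sat J(1)] conj_true_sdom[OF structJ Jbody] Jbody])
  have wJ: "w ` conj_vars \<psi> \<subseteq> sdom J" by (rule conj_true_sdom[OF structJ w(2)])
  moreover have "conj_vars \<psi> \<noteq> {}"
    using \<sigma>(1) \<psi> by (intro conj_vars_nonempty[OF assms(1)]) (auto simp: is_dexr_def)
  ultimately obtain a where a: "a \<in> sdom J" by blast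
  \<comment> \<open>The witness \<open>w\<close> is carried over to the \<open>y\<close> variables
    by inverting the numbering; indices that number no variable get the default
    \<open>a\<close>.\<close>
  define u where "u i = (if i \<in> g \<psi> ` ex_vars \<sigma> \<psi>
    then w (inv_into (ex_vars \<sigma> \<psi>) (g \<psi>) i) else a)" for i
  have u: "u (g \<psi> x) = w x" if "x \<in> ex_vars \<sigma> \<psi>" for x
    using that g(1)[OF \<psi>] by (simp add: u_def)
  have "\<forall>i. u i \<in> sdom J"
  proof
    fix i show "u i \<in> sdom J"
    proof (cases "i \<in> g \<psi> ` ex_vars \<sigma> \<psi>")
      case True
      then obtain x where x: "x \<in> ex_vars \<sigma> \<psi>" "i = g \<psi> x" by blast
      then show ?thesis using u wJ by (auto simp: ex_vars_def)
    qed (simp add: u_def a)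
  qed
  moreover have "conj_true J (trm_val u \<circ> tr \<psi>) \<psi>"
    using w u by (subst conj_true_cong[where w = w]) (auto simp: tr_def ex_vars_def)
  ultimately have "sat_ex J m (map_conj (tr \<psi>) \<psi>)"
    by (auto simp: sat_ex_def conj_true_map_conj)
  moreover have "NegEx m (map_conj (tr \<psi>) \<psi>) \<in> diagram K m G"
    using \<psi> by (auto simp: diagram_def G_def)
  ultimately show False using J(2) by fastforce
qed

section \<open>Realizing diagrams along maps that need not be injective\<close>

text \<open>The set \<open>A\<close> and its image have equal finite size, so their complements in
  the union \<open>?U\<close> have equal size too and can be matched by a bijection
  \<open>q\<close>. Outside \<open>?U\<close> the identity works.\<close>

lemma ex_bij_extending:
  assumes "finite A" "inj_on f A"
  shows "\<exists>p :: 'a \<Rightarrow> 'a. bij p \<and> (\<forall>x\<in>A. p x = f x)"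
proof -
  let ?U = "A \<union> f ` A"
  have "card (?U - A) = card (?U - f ` A)"
    using assms by (simp add: card_Diff_subset card_image)
  then obtain q where q: "bij_betw q (?U - A) (?U - f ` A)"
    using finite_same_card_bij[of "?U - A" "?U - f ` A"] assms(1) by blast
  define p where "p x = (if x \<in> A then f x else if x \<in> ?U then q x else x)" for x
  have "bij_betw p A (f ` A)"
    using assms(2) by (auto simp: bij_betw_def p_def inj_on_def)
  moreover have "bij_betw p (?U - A) (?U - f ` A)"
    using q by (subst bij_betw_cong[where g = q]) (auto simp: p_def)
  moreover have "bij_betw p (- ?U) (- ?U)"
    by (subst bij_betw_cong[where g = id]) (auto simp: p_def)
  ultimately have "bij_betw p (A \<union> (?U - A) \<union> - ?U) (f ` A \<union> (?U - f ` A) \<union> - ?U)"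
    by (intro bij_betw_combine) auto
  moreover have "A \<union> (?U - A) \<union> - ?U = UNIV" "f ` A \<union> (?U - f ` A) \<union> - ?U = UNIV"
    by auto
  ultimately have "bij p" by metis
  then show ?thesis by (auto simp: p_def intro!: exI[of _ p])
qed

text \<open>In contrast to \<open>trm_val\<close>, constants are read through \<open>f\<close>. This
  expresses the truth of a diagram conjunction in a structure where the elements of \<open>K\<close>
  are represented by other elements, possibly with repetitions.\<close>

fun trm_eval :: "('c \<Rightarrow> 'd) \<Rightarrow> (nat \<Rightarrow> 'd) \<Rightarrow> 'c trm \<Rightarrow> 'd" where
  "trm_eval f u (Const c) = f c"
| "trm_eval f u (YVar i) = u i"

text \<open>Here \<open>\<phi>\<close> lists the facts of a finite structure, mapped injectively to \<open>L\<close>.\<close>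

lemma realize_embedding:
  fixes L :: "('r, 'c) rstruct"
  assumes "collection S ar \<C>" "L \<in> \<C>" "finite D" "inj_on f D"
    and "conj_vars \<phi> \<subseteq> D" "conj_true L f \<phi>"
  obtains J where "J \<in> \<C>" "conj_true J id \<phi>"
    "\<And>m \<gamma>. conj_vars \<gamma> \<subseteq> Const ` D \<union> range YVar \<Longrightarrow> sat_ex J m \<gamma> \<Longrightarrow>
       \<exists>u. (\<forall>i<m. u i \<in> sdom L) \<and> conj_true L (trm_eval f u) \<gamma>"
proof -
  \<comment> \<open>Renaming \<open>L\<close> by the inverse of a permutation that extends
    \<open>f\<close> gives an isomorphic copy in which \<open>f c\<close> has become
    \<open>c\<close>, so that constants can denote themselves.\<close>
  obtain p where p: "bij p" "\<forall>x\<in>D. p x = f x"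
    using ex_bij_extending[OF assms(3,4)] by blast
  let ?J = "rename (inv p) L"
  have ipp: "inv p (p x) = x" "p (inv p x) = x" for x
    using p(1) by (simp_all add: bij_is_inj bij_is_surj surj_f_inv_f)
  have hom: "hom (inv p) L ?J" by (auto simp: hom_def rename_def)
  have homp: "hom p ?J L" by (auto simp: hom_def rename_def ipp comp_def)
  show thesis
  proof
    show "?J \<in> \<C>"
      using assms(1,2) bij_is_inj[OF bij_imp_bij_inv[OF p(1)]] by (rule collection_rename)
    have "conj_true ?J (inv p \<circ> f) \<phi>" by (rule conj_true_hom[OF hom assms(6)])
    moreover have "(inv p \<circ> f) x = id x" if "x \<in> conj_vars \<phi>" for x
      using that assms(5) p(2) ipp(1)[of x] by auto
    ultimately show "conj_true ?J id \<phi>"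
      using conj_true_cong[of \<phi> "inv p \<circ> f" id ?J] by blast
  next
    fix m \<gamma> assume \<gamma>: "conj_vars \<gamma> \<subseteq> Const ` D \<union> range YVar" "sat_ex ?J m \<gamma>"
    then obtain u where u: "\<forall>i<m. u i \<in> sdom ?J" "conj_true ?J (trm_val u) \<gamma>"
      by (auto simp: sat_ex_def)
    have "conj_true L (p \<circ> trm_val u) \<gamma>" by (rule conj_true_hom[OF homp u(2)])
    moreover have "(p \<circ> trm_val u) t = trm_eval f (p \<circ> u) t" if "t \<in> conj_vars \<gamma>" for t
      using that \<gamma>(1) p(2) by auto
    ultimately have "conj_true L (trm_eval f (p \<circ> u)) \<gamma>"
      by (metis conj_true_cong)
    moreover have "\<forall>i<m. (p \<circ> u) i \<in> sdom L"
      using u(1) homp by (auto simp: hom_def)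
    ultimately show "\<exists>u. (\<forall>i<m. u i \<in> sdom L) \<and> conj_true L (trm_eval f u) \<gamma>" by blast
  qed
qed

text \<open>Pairing \<open>f\<close> with an injection \<open>q\<close> into a critical structure
  \<open>Q\<close> gives an injective map, and atoms survive because all tuples hold in
  \<open>Q\<close>. The homomorphism \<open>h\<close> from the repairable product \<open>L\<close>
  to \<open>J\<close> sends each pair back to its first component, so a conjunction that becomes
  true in \<open>L\<close> was already true in \<open>J\<close> under \<open>f\<close>.\<close>

lemma realize_hom:
  fixes J :: "('r, 'c) rstruct"
  assumes "collection S ar \<C>" "critical S ar \<C>" "closed_repairable_products S ar \<C>"
    and "J \<in> \<C>" "finite D" "f ` D \<subseteq> sdom J"
    and "\<forall>\<alpha>\<in>set \<phi>. atom_over S ar D \<alpha>" "conj_true J f \<phi>"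
  obtains J' where "J' \<in> \<C>" "conj_true J' id \<phi>"
    "\<And>m \<gamma>. conj_vars \<gamma> \<subseteq> Const ` D \<union> range YVar \<Longrightarrow> sat_ex J' m \<gamma> \<Longrightarrow>
       \<exists>u. (\<forall>i<m. u i \<in> sdom J) \<and> conj_true J (trm_eval f u) \<gamma>"
proof -
  \<comment> \<open>The successor keeps the size positive, as criticality requires, also when
    \<open>D\<close> is empty.\<close>
  obtain Q where Q: "Q \<in> \<C>" "k_critical S ar (Suc (card D)) Q"
    using assms(2) unfolding critical_def by blast
  then have "finite (sdom Q)" "card D \<le> card (sdom Q)"
    by (auto simp: k_critical_def)
  then obtain q where q: "q ` D \<subseteq> sdom Q" "inj_on q D"
    using card_le_inj[OF assms(5)] by blast
  obtain L where L: "L \<in> \<C>" "repairable_product S ar J Q L"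
    using assms(3,4) Q(1) unfolding closed_repairable_products_def by blast
  then obtain P e h where P: "iso e (direct_product J Q) P" "substruct P L" "sdom P \<subseteq> sdom L"
      "hom h L J" "\<forall>p\<in>sdom (direct_product J Q). h (e p) = fst p"
    unfolding repairable_product_def by blast
  define f' where "f' = e \<circ> (\<lambda>c. (f c, q c))"
  have pair: "(f c, q c) \<in> sdom (direct_product J Q)" if "c \<in> D" for c
    using that assms(6) q(1) by (auto simp: direct_product_def)
  have inj: "inj_on f' D"
    unfolding f'_def
  proof (rule comp_inj_on)
    show "inj_on (\<lambda>c. (f c, q c)) D" using q(2) by (auto simp: inj_on_def)
    show "inj_on e ((\<lambda>c. (f c, q c)) ` D)"
      using P(1) pair by (auto simp: iso_def bij_betw_def intro: inj_on_subset)
  qed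
  have vars: "conj_vars \<phi> \<subseteq> D" by (rule conj_vars_atom_over[OF assms(7)])
  have trueQ: "conj_true Q q \<phi>"
    by (rule conj_true_critical[OF _ assms(7) q(1)]) (use Q(2) in \<open>simp add: k_critical_def\<close>)
  have "conj_true L f' \<phi>"
    unfolding conj_true_def
  proof (clarify)
    fix R ts assume ts: "(R, ts) \<in> set \<phi>"
    let ?t = "map (\<lambda>c. (f c, q c)) ts"
    have "map f ts \<in> srel J R" "map q ts \<in> srel Q R"
      using assms(8) trueQ ts by (auto simp: conj_true_def)
    then have "?t \<in> srel (direct_product J Q) R" by (simp add: direct_product_def comp_def)
    moreover have "set ts \<subseteq> D" using ts vars by (force simp: conj_vars_def)
    then have "set ?t \<subseteq> sdom (direct_product J Q)" using pair by auto
    ultimately have "map e ?t \<in> srel P R" using P(1) unfolding iso_def by blast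
    then show "map f' ts \<in> srel L R"
      using P(2) by (auto simp: substruct_def facts_def f'_def comp_def)
  qed
  then obtain J' where J': "J' \<in> \<C>" "conj_true J' id \<phi>"
    "\<And>m \<gamma>. conj_vars \<gamma> \<subseteq> Const ` D \<union> range YVar \<Longrightarrow> sat_ex J' m \<gamma> \<Longrightarrow>
       \<exists>u. (\<forall>i<m. u i \<in> sdom L) \<and> conj_true L (trm_eval f' u) \<gamma>"
    using realize_embedding[OF assms(1) L(1) assms(5) inj vars] by blast
  have "\<exists>u. (\<forall>i<m. u i \<in> sdom J) \<and> conj_true J (trm_eval f u) \<gamma>"
    if \<gamma>: "conj_vars \<gamma> \<subseteq> Const ` D \<union> range YVar" "sat_ex J' m \<gamma>" for m \<gamma>
  proof -
    obtain u where u: "\<forall>i<m. u i \<in> sdom L" "conj_true L (trm_eval f' u) \<gamma>"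
      using J'(3)[OF \<gamma>] by blast
    have "conj_true J (h \<circ> trm_eval f' u) \<gamma>" by (rule conj_true_hom[OF P(4) u(2)])
    \<comment> \<open>On \<open>D\<close> the composition of \<open>h\<close> with \<open>f'\<close>
      is \<open>f\<close>, because \<open>h\<close> extends the projection; the values of the
      \<open>y\<close> variables are simply moved by \<open>h\<close>.\<close>
    moreover have "(h \<circ> trm_eval f' u) t = trm_eval f (h \<circ> u) t" if "t \<in> conj_vars \<gamma>" for t
      using that \<gamma>(1) P(5) pair by (auto simp: f'_def)
    ultimately have "conj_true J (trm_eval f (h \<circ> u)) \<gamma>" by (metis conj_true_cong)
    moreover have "\<forall>i<m. (h \<circ> u) i \<in> sdom J" using u(1) P(4) by (auto simp: hom_def)
    ultimately show ?thesis by blast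
  qed
  with J'(1,2) show thesis by (rule that)
qed

section \<open>A finite supply of rules\<close>

text \<open>Conjunctions are lists, so finitely many atoms still allow infinitely many heads;
  requiring \<open>distinct\<close> disjuncts restores finiteness, and repeating an atom never
  changes truth. The bound \<open>k\<close> will be \<open>n + m\<close>: names for the body
  variables and for existential variables shared by all disjuncts.\<close>

definition canonical_rules :: "'r set \<Rightarrow> ('r \<Rightarrow> nat) \<Rightarrow> nat \<Rightarrow> nat \<Rightarrow> 'r dexr set" where
  "canonical_rules S ar k l =
     {\<sigma>. length (body \<sigma>) \<le> 1 \<and> set (body \<sigma>) \<subseteq> {\<alpha>. atom_over S ar {..<k} \<alpha>} \<and>
        length (heads \<sigma>) \<le> l \<and>
        set (heads \<sigma>) \<subseteq> {\<psi>. distinct \<psi> \<and> set \<psi> \<subseteq> {\<alpha>. atom_over S ar {..<k} \<alpha>}}}"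

lemma finite_canonical_rules:
  fixes S :: "'r set"
  assumes "schema S ar"
  shows "finite (canonical_rules S ar k l)"
proof -
  let ?A = "{\<alpha>. atom_over S ar {..<k} \<alpha>}"
  let ?D = "{\<psi>. distinct \<psi> \<and> set \<psi> \<subseteq> ?A}"
  have "finite (tuples j {..<k})" for j
    using finite_lists_length_eq[of "{..<k}" j] by (simp add: tuples_def conj_commute)
  moreover have "?A \<subseteq> (SIGMA R:S. tuples (ar R) {..<k})"
    by (auto simp: atom_over_def)
  ultimately have finA: "finite ?A"
    using assms by (elim finite_subset) (auto simp: schema_def)
  then have finD: "finite ?D" using finite_subset_distinct[of ?A] by (simp add: conj_commute)
  have "canonical_rules S ar k l \<subseteq> (\<lambda>(b, h). \<lparr>body = b, heads = h\<rparr>) `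
      ({b. set b \<subseteq> ?A \<and> length b \<le> 1} \<times> {h. set h \<subseteq> ?D \<and> length h \<le> l})"
  proof
    fix \<sigma> :: "'r dexr" assume "\<sigma> \<in> canonical_rules S ar k l"
    then show "\<sigma> \<in> (\<lambda>(b, h). \<lparr>body = b, heads = h\<rparr>) `
      ({b. set b \<subseteq> ?A \<and> length b \<le> 1} \<times> {h. set h \<subseteq> ?D \<and> length h \<le> l})"
      by (intro image_eqI[of _ _ "(body \<sigma>, heads \<sigma>)"]) (auto simp: canonical_rules_def)
  qed
  then show ?thesis
    using finite_lists_length_le[OF finA, of 1] finite_lists_length_le[OF finD, of l]
    by (meson finite_SigmaI finite_imageI finite_subset)
qed

section \<open>Models of the valid rules are compatible with the collection\<close>

lemma lin_diag_compatible_with_model: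
  fixes I :: "('r, 'c) rstruct"
  assumes "schema S ar" "collection S ar \<C>" "critical S ar \<C>" "closed_repairable_products S ar \<C>"
    and structI: "is_struct S ar I"
    and model: "\<And>\<sigma>. \<sigma> \<in> canonical_rules S ar (n + m) l \<Longrightarrow> is_dexr S ar \<sigma> \<Longrightarrow> linear_dexr \<sigma> \<Longrightarrow>
      bounded_dexr n m l \<sigma> \<Longrightarrow> \<forall>J\<in>\<C>. sat_dexr J \<sigma> \<Longrightarrow> sat_dexr I \<sigma>"
  shows "lin_diag_compatible_with S ar n m l \<C> I"
  unfolding lin_diag_compatible_with_def
proof (intro allI impI)
  fix K :: "('r, 'c) rstruct" and \<Delta>
  assume "is_struct S ar K \<and> linear_struct K \<and> substruct K I \<and> sdom K = adom K \<and>
          finite (sdom K) \<and> card (sdom K) \<le> n"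
    and "is_diagram S ar m l I K \<Delta>"
  then obtain G where K: "is_struct S ar K" "linear_struct K" "substruct K I" "sdom K = adom K"
      "finite (sdom K)" "card (sdom K) \<le> n"
    and G: "G \<subseteq> neg_conjs S ar I K m" "finite G" "card G \<le> l" "\<Delta> = diagram K m G"
    unfolding is_diagram_def by blast
  let ?D = "sdom K" and ?T = "Const ` sdom K \<union> YVar ` {..<m}"
  obtain \<phi> where \<phi>: "set \<phi> = facts K" "length \<phi> \<le> 1"
    using K(2) finite_distinct_list[of "facts K"]
    by (auto simp: linear_struct_def) (metis distinct_card One_nat_def)
  have over\<phi>: "\<forall>\<alpha>\<in>set \<phi>. atom_over S ar ?D \<alpha>"
    using is_structD[OF K(1)] by (fastforce simp: \<phi>(1) facts_def atom_over_def tuples_def)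
  have vars\<phi>: "conj_vars \<phi> = ?D"
    by (simp add: conj_vars_def \<phi>(1) K(4) adom_def)
  have \<gamma>: "\<gamma> \<noteq> []" "\<forall>\<alpha>\<in>set \<gamma>. atom_over S ar ?T \<alpha>" "\<not> sat_ex I m \<gamma>" if "\<gamma> \<in> G" for \<gamma>
    using G(1) that by (auto simp: neg_conjs_def diag_conjs_def diag_atoms_def)
  have vars\<gamma>: "conj_vars \<gamma> \<subseteq> ?T" if "\<gamma> \<in> G" for \<gamma>
    by (rule conj_vars_atom_over[OF \<gamma>(2)[OF that]])
  \<comment> \<open>Reduces the goal to a member \<open>J\<close> and a map \<open>f\<close>,
    possibly not injective, under which the facts of \<open>K\<close> hold and no conjunction in
    \<open>G\<close> can be satisfied.\<close>
  have realize: "\<exists>J\<in>\<C>. \<forall>\<delta>\<in>\<Delta>. sat_conjunct J \<delta>"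
    if J: "J \<in> \<C>" "f ` ?D \<subseteq> sdom J" "conj_true J f \<phi>"
      and no: "\<And>\<gamma> u. \<gamma> \<in> G \<Longrightarrow> \<forall>i<m. u i \<in> sdom J \<Longrightarrow> \<not> conj_true J (trm_eval f u) \<gamma>"
    for J f
  proof -
    obtain J' where J': "J' \<in> \<C>" "conj_true J' id \<phi>"
      "\<And>m \<gamma>. conj_vars \<gamma> \<subseteq> Const ` ?D \<union> range YVar \<Longrightarrow> sat_ex J' m \<gamma> \<Longrightarrow>
         \<exists>u. (\<forall>i<m. u i \<in> sdom J) \<and> conj_true J (trm_eval f u) \<gamma>"
      using realize_hom[OF assms(2-4) J(1) K(5) J(2) over\<phi> J(3)] by blast
    have "\<not> sat_ex J' m \<gamma>" if "\<gamma> \<in> G" for \<gamma>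
      using J'(3)[of \<gamma> m] no[OF that] vars\<gamma>[OF that] by blast
    moreover have "t \<in> srel J' R" if "(R, t) \<in> facts K" for R t
      using J'(2) that unfolding conj_true_def \<phi>(1) by auto
    ultimately have "\<forall>\<delta>\<in>\<Delta>. sat_conjunct J' \<delta>" by (auto simp: G(4) diagram_def)
    then show ?thesis using J'(1) by blast
  qed
  show "\<exists>J\<in>\<C>. \<forall>\<delta>\<in>\<Delta>. sat_conjunct J \<delta>"
  \<comment> \<open>Rules need at least one head disjunct, so an empty \<open>G\<close> yields no
    rule. Only facts must then be realized, and a one-element critical structure does this.\<close>
  proof (cases "G = {}")
    case True
    obtain Q where Q: "Q \<in> \<C>" "k_critical S ar 1 Q"
      using assms(3) unfolding critical_def by (metis zero_less_one)
    then obtain a where "a \<in> sdom Q" by (fastforce simp: k_critical_def)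
    then have a: "(\<lambda>_. a) ` ?D \<subseteq> sdom Q" by blast
    have "conj_true Q (\<lambda>_. a) \<phi>"
      by (rule conj_true_critical[OF _ over\<phi> a]) (use Q(2) in \<open>simp add: k_critical_def\<close>)
    with Q(1) a show ?thesis by (rule realize) (simp add: True)
  next
    case False
    obtain g where g: "g ` ?D \<subseteq> {..<n}" "inj_on g ?D"
      using card_le_inj[OF K(5), of "{..<n}"] K(6) by auto
    obtain Gs where Gs: "set Gs = G" "length Gs \<le> l"
      using finite_distinct_list[OF G(2)] G(3) distinct_card by metis
    \<comment> \<open>Elements of \<open>K\<close> become variables below \<open>n\<close> through
      \<open>g\<close>, and \<open>YVar i\<close> becomes the variable \<open>n + i\<close>, so the
      two kinds never clash.\<close>
    let ?r = "trm_eval g ((+) n)"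
    define \<sigma> :: "'r dexr" where
      "\<sigma> = \<lparr>body = map_conj g \<phi>, heads = map (\<lambda>\<gamma>. remdups (map_conj ?r \<gamma>)) Gs\<rparr>"
    have heads: "set (heads \<sigma>) = (\<lambda>\<gamma>. remdups (map_conj ?r \<gamma>)) ` G"
      by (simp add: \<sigma>_def Gs(1))
    have B: "conj_vars (body \<sigma>) = g ` ?D"
      by (simp add: \<sigma>_def conj_vars_map_conj vars\<phi>)
    have conj_vars_remdups: "conj_vars (remdups \<psi>) = conj_vars \<psi>" for \<psi> :: "('r, nat) atom list"
      by (simp add: conj_vars_def)
    have conj_true_remdups: "conj_true J w (remdups \<psi>) = conj_true J w \<psi>"
      for \<psi> :: "('r, nat) atom list" and J :: "('r, 'c) rstruct" and w
      by (simp add: conj_true_def)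
    \<comment> \<open>Each constant in \<open>\<gamma>\<close> is an element of \<open>K\<close>,
      hence occurs in a fact, and so its variable occurs in the body. Only shifted \<open>y\<close>
      variables remain existential.\<close>
    have ex: "ex_vars \<sigma> (remdups (map_conj ?r \<gamma>)) \<subseteq> {n..<n + m}" if "\<gamma> \<in> G" for \<gamma>
      using vars\<gamma>[OF that] by (fastforce simp: ex_vars_def conj_vars_remdups conj_vars_map_conj B)
    have over_body: "\<forall>\<alpha>\<in>set (body \<sigma>). atom_over S ar {..<n + m} \<alpha>"
      using g(1) unfolding \<sigma>_def by (simp, intro atom_over_map_conj[OF over\<phi>]) auto
    have over_head: "\<forall>\<alpha>\<in>set (map_conj ?r \<gamma>). atom_over S ar {..<n + m} \<alpha>" if "\<gamma> \<in> G" for \<gamma>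
      using g(1) by (intro atom_over_map_conj[OF \<gamma>(2)[OF that]]) auto
    have len: "length (body \<sigma>) \<le> 1" "length (heads \<sigma>) \<le> l"
      using \<phi>(2) Gs(2) by (simp_all add: \<sigma>_def map_conj_def)
    have canon: "\<sigma> \<in> canonical_rules S ar (n + m) l"
      using over_body over_head len by (auto simp: canonical_rules_def heads)
    have atom_over_UNIV: "atom_over S ar UNIV \<alpha>" if "atom_over S ar {..<n + m} \<alpha>" for \<alpha>
      using that by (auto simp: atom_over_def tuples_def)
    have "heads \<sigma> \<noteq> []" using False Gs(1) by (auto simp: \<sigma>_def)
    then have dexr: "is_dexr S ar \<sigma>"
      using over_body over_head \<gamma>(1) by (auto simp: is_dexr_def heads intro: atom_over_UNIV)
    have "card (g ` ?D) \<le> n" using card_image_le[OF K(5), of g] K(6) by simp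
    moreover have "card (ex_vars \<sigma> (remdups (map_conj ?r \<gamma>))) \<le> m" if "\<gamma> \<in> G" for \<gamma>
      using card_mono[OF _ ex[OF that]] by simp
    ultimately have bounded: "bounded_dexr n m l \<sigma>"
      using len(2) by (auto simp: bounded_dexr_def B heads)
    \<comment> \<open>Undoing the numbering \<open>g\<close> makes the body true in
      \<open>I\<close>, as \<open>K\<close> is contained in \<open>I\<close>; a true head would
      satisfy a conjunction of \<open>G\<close> in \<open>I\<close>.\<close>
    have "\<not> sat_dexr I \<sigma>"
    proof
      assume sat: "sat_dexr I \<sigma>"
      define v where "v = inv_into ?D g"
      have vg: "v (g c) = c" if "c \<in> ?D" for c
        unfolding v_def using g(2) that by (rule inv_into_f_f)
      have "conj_true I id \<phi>"
        using K(3) by (auto simp: conj_true_def \<phi>(1) substruct_def facts_def)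
      then have "conj_true I (v \<circ> g) \<phi>"
        by (subst conj_true_cong[where w = id]) (auto simp: vars\<phi> vg)
      then have body: "conj_true I v (body \<sigma>)" by (simp add: \<sigma>_def conj_true_map_conj)
      obtain \<psi> w where \<psi>: "\<psi> \<in> set (heads \<sigma>)" "conj_true I w \<psi>"
        and wB: "\<forall>x\<in>conj_vars (body \<sigma>). w x = v x"
        by (rule sat_dexrE[OF sat conj_true_sdom[OF structI body] body])
      from \<psi>(1) obtain \<gamma>' where \<gamma>': "\<gamma>' \<in> G" and eq: "\<psi> = remdups (map_conj ?r \<gamma>')"
        unfolding heads by blast
      have w: "\<forall>x\<in>g ` ?D. w x = v x" "conj_true I (w \<circ> ?r) \<gamma>'"
        using wB \<psi>(2) by (simp_all add: B eq conj_true_remdups conj_true_map_conj)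
      have wI: "(w \<circ> ?r) ` conj_vars \<gamma>' \<subseteq> sdom I" by (rule conj_true_sdom[OF structI w(2)])
      moreover have "conj_vars \<gamma>' \<noteq> {}"
        by (rule conj_vars_nonempty[OF assms(1) \<gamma>(1,2)]) (rule \<gamma>')+
      ultimately obtain a where a: "a \<in> sdom I" by blast
      \<comment> \<open>The value of \<open>w\<close> is known to lie in the domain only at
        variables that occur in the conjunction; elsewhere it may have to be replaced by
        \<open>a\<close>.\<close>
      define u where "u i = (if w (n + i) \<in> sdom I then w (n + i) else a)" for i
      have "(w \<circ> ?r) t = trm_val u t" if "t \<in> conj_vars \<gamma>'" for t
      proof (cases t)
        case (Const c)
        then have "c \<in> ?D" using vars\<gamma>[OF \<gamma>'] that by auto
        then show ?thesis using Const w(1) vg by simp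
      next
        case (YVar i)
        have "(w \<circ> ?r) t \<in> sdom I" using wI that by blast
        then show ?thesis using YVar by (simp add: u_def)
      qed
      then have "conj_true I (trm_val u) \<gamma>'" using w(2) by (metis conj_true_cong)
      moreover have "\<forall>i<m. u i \<in> sdom I" using a by (simp add: u_def)
      ultimately show False using \<gamma>(3)[OF \<gamma>'] by (auto simp: sat_ex_def)
    qed
    \<comment> \<open>A rule of this form valid throughout the collection would hold in
      \<open>I\<close>, so \<open>\<sigma>\<close> must fail in some member.\<close>
    then obtain J where J: "J \<in> \<C>" "\<not> sat_dexr J \<sigma>"
      using model[OF canon dexr _ bounded] len(1) by (auto simp: linear_dexr_def)
    from J(2) obtain v where v: "v ` conj_vars (body \<sigma>) \<subseteq> sdom J" "conj_true J v (body \<sigma>)"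
      and no: "\<And>\<psi> w. \<psi> \<in> set (heads \<sigma>) \<Longrightarrow> \<forall>x\<in>conj_vars (body \<sigma>). w x = v x \<Longrightarrow>
        w ` ex_vars \<sigma> \<psi> \<subseteq> sdom J \<Longrightarrow> \<not> conj_true J w \<psi>"
      by (rule not_sat_dexrE) blast
    show ?thesis
    proof (rule realize[OF J(1), of "v \<circ> g"])
      show "(v \<circ> g) ` ?D \<subseteq> sdom J" using v(1) by (simp add: B image_comp)
      show "conj_true J (v \<circ> g) \<phi>" using v(2) by (simp add: \<sigma>_def conj_true_map_conj)
    next
      fix \<gamma>' u assume \<gamma>': "\<gamma>' \<in> G" and u: "\<forall>i<m. u i \<in> sdom J"
      \<comment> \<open>Glues the body assignment below \<open>n\<close> to the values of the
        \<open>y\<close> variables, shifted by \<open>n\<close> to match \<open>?r\<close>.\<close>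
      define w where "w x = (if x < n then v x else u (x - n))" for x
      have wB: "\<forall>x\<in>g ` ?D. w x = v x" using g(1) by (auto simp: w_def)
      have "w ` {n..<n + m} \<subseteq> sdom J" using u by (auto simp: w_def)
      then have "w ` ex_vars \<sigma> (remdups (map_conj ?r \<gamma>')) \<subseteq> sdom J"
        using ex[OF \<gamma>'] by blast
      then have "\<not> conj_true J w (remdups (map_conj ?r \<gamma>'))"
        using no wB \<gamma>' by (simp add: heads B)
      then have "\<not> conj_true J (w \<circ> ?r) \<gamma>'"
        by (simp add: conj_true_remdups conj_true_map_conj)
      moreover have "(w \<circ> ?r) t = trm_eval (v \<circ> g) u t" if "t \<in> conj_vars \<gamma>'" for t
      proof (cases t)
        case (Const c)
        then have "c \<in> ?D" using vars\<gamma>[OF \<gamma>'] that by auto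
        then show ?thesis using Const wB by simp
      qed (simp add: w_def)
      ultimately show "\<not> conj_true J (trm_eval (v \<circ> g) u) \<gamma>'" by (metis conj_true_cong)
    qed
  qed
qed

section \<open>The equivalence of axiomatizability with the three closure conditions\<close>

theorem theorem2:
  fixes S :: "'r set" and ar :: "'r \<Rightarrow> nat"
    and \<C> :: "('r, 'c) rstruct set"
    and n m l :: nat
  assumes "countable (UNIV :: 'c set)" and "infinite (UNIV :: 'c set)"
    and "schema S ar"
    and "collection S ar \<C>"
    and "n + m > 0" and "l > 0"
  shows "finitely_axiomatizable_by S ar (\<lambda>\<sigma>. linear_dexr \<sigma> \<and> bounded_dexr n m l \<sigma>) \<C> \<longleftrightarrow>
    critical S ar \<C> \<and> closed_repairable_products S ar \<C> \<and> lin_diag_compatible S ar n m l \<C>"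
proof
  assume "finitely_axiomatizable_by S ar (\<lambda>\<sigma>. linear_dexr \<sigma> \<and> bounded_dexr n m l \<sigma>) \<C>"
  then obtain \<Sigma> where \<Sigma>: "\<And>\<sigma>. \<sigma> \<in> \<Sigma> \<Longrightarrow> is_dexr S ar \<sigma> \<and> linear_dexr \<sigma> \<and> bounded_dexr n m l \<sigma>"
    and ax: "\<And>I. is_struct S ar I \<Longrightarrow> I \<in> \<C> \<longleftrightarrow> (\<forall>\<sigma>\<in>\<Sigma>. sat_dexr I \<sigma>)"
    unfolding finitely_axiomatizable_by_def by blast
  have struct: "is_struct S ar I" if "I \<in> \<C>" for I
    using assms(4) that by (rule collection_is_struct)
  have "\<exists>I\<in>\<C>. k_critical S ar \<kappa> I" if "\<kappa> > 0" for \<kappa>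
  proof -
    obtain I :: "('r, 'c) rstruct" where I: "is_struct S ar I" "k_critical S ar \<kappa> I"
      using ex_k_critical[OF assms(2)] by blast
    then show ?thesis using ax[OF I(1)] sat_dexr_critical[OF I(2) that] \<Sigma> by blast
  qed
  then have "critical S ar \<C>" by (simp add: critical_def)
  moreover have "closed_repairable_products S ar \<C>"
    unfolding closed_repairable_products_def
  proof (intro ballI)
    fix I J assume IJ: "I \<in> \<C>" "J \<in> \<C>"
    obtain e :: "'c \<times> 'c \<Rightarrow> 'c" where e: "bij e"
      using ex_bij_prod[OF assms(1,2)] by blast
    let ?L = "pullback (fst \<circ> inv e) I"
    \<comment> \<open>Surjectivity lets existential witnesses be lifted, so the inverse image of
      \<open>I\<close> is again a model of \<open>\<Sigma>\<close>.\<close>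
    have "surj (fst \<circ> inv e)"
      by (intro comp_surj bij_is_surj[OF bij_imp_bij_inv[OF e]])
        (metis UNIV_Times_UNIV UNIV_not_empty fst_image_times)
    then have "?L \<in> \<C>"
      using ax[OF is_struct_pullback[OF struct[OF IJ(1)]]] ax[OF struct[OF IJ(1)]] IJ(1)
        sat_dexr_pullback by blast
    then show "\<exists>L\<in>\<C>. repairable_product S ar I J L"
      using repairable_product_pullback[OF struct[OF IJ(1)] struct[OF IJ(2)] e] by blast
  qed
  moreover have "lin_diag_compatible S ar n m l \<C>"
    unfolding lin_diag_compatible_def
  proof (intro allI impI)
    fix I assume I: "is_struct S ar I \<and> lin_diag_compatible_with S ar n m l \<C> I"
    have "sat_dexr I \<sigma>" if "\<sigma> \<in> \<Sigma>" for \<sigma>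
      using sat_dexr_if_lin_diag_compatible_with[OF assms(3,4), of I n m l \<sigma>] I \<Sigma>[OF that]
        ax struct that by blast
    then show "I \<in> \<C>" using ax I by blast
  qed
  ultimately show "critical S ar \<C> \<and> closed_repairable_products S ar \<C> \<and>
      lin_diag_compatible S ar n m l \<C>" by blast
next
  assume R: "critical S ar \<C> \<and> closed_repairable_products S ar \<C> \<and>
      lin_diag_compatible S ar n m l \<C>"
  define \<Sigma> where "\<Sigma> = {\<sigma> \<in> canonical_rules S ar (n + m) l.
    is_dexr S ar \<sigma> \<and> linear_dexr \<sigma> \<and> bounded_dexr n m l \<sigma> \<and> (\<forall>J\<in>\<C>. sat_dexr J \<sigma>)}"
  have "finite \<Sigma>" using finite_canonical_rules[OF assms(3)] by (simp add: \<Sigma>_def)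
  moreover have "I \<in> \<C> \<longleftrightarrow> (\<forall>\<sigma>\<in>\<Sigma>. sat_dexr I \<sigma>)" if I: "is_struct S ar I" for I
  proof
    assume "\<forall>\<sigma>\<in>\<Sigma>. sat_dexr I \<sigma>"
    \<comment> \<open>\<open>\<Sigma>\<close> contains every candidate rule valid in the collection,
      so being a model of it is just the assumption on \<open>I\<close> in
      \<open>lin_diag_compatible_with_model\<close>.\<close>
    then have "lin_diag_compatible_with S ar n m l \<C> I"
      using R by (intro lin_diag_compatible_with_model[OF assms(3,4) _ _ I]) (auto simp: \<Sigma>_def)
    then show "I \<in> \<C>" using R I unfolding lin_diag_compatible_def by blast
  qed (simp add: \<Sigma>_def)
  ultimately show "finitely_axiomatizable_by S ar (\<lambda>\<sigma>. linear_dexr \<sigma> \<and> bounded_dexr n m l \<sigma>) \<C>"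
    unfolding finitely_axiomatizable_by_def by (intro exI[of _ \<Sigma>]) (auto simp: \<Sigma>_def)
qed

end
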